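(* Let $A\in\mathbb{R}^{m\times n}$, $m\ge n$, have full column rank, let $\mathbf{b}\in\mathbb{R}^m$, let $W\in\mathbb{R}^{m\times m}$ be symmetric positive definite, and let $L\in\mathbb{R}^{n\times k}$, $k\le n$. Let $\mathcal{K}_\infty$ and $\mathcal{K}_c$ be the mixed and componentwise condition numbers at $(A,\mathbf{b})$ of the weighted least squares solution map $g(A,\mathbf{b})=L^{\mathrm T}(A^{\mathrm T}WA)^{-1}A^{\mathrm T}W\mathbf{b}$. Then $$\mathcal{K}_{\infty}\le\mathcal{K}_{\infty}^u:=\big\|L^{\mathrm T}(A^{\mathrm T}WA)^{-1}D_{|A|^{\mathrm T}|\mathbf{d}|}\big\|_\infty+\big\|L^{\mathrm T}A_{W,I_n}^{\dagger}D_{|A|\,|\mathbf{x}|}\big\|_\infty+\big\|L^{\mathrm T}A_{W,I_n}^{\dagger}D_{|\mathbf{b}|}\big\|_\infty,$$ and, when all components of $L^{\mathrm T}\mathbf{x}$ are nonzero (so that $\mathcal{K}_c$ is defined), $$\mathcal{K}_c\le\mathcal{K}_c^u:=\big\|D_{L^{\mathrm T}\mathbf{x}}^{-1}L^{\mathrm T}(A^{\mathrm T}WA)^{-1}D_{|A|^{\mathrm T}|\mathbf{d}|}\big\|_\infty+\big\|D_{L^{\mathrm T}\mathbf{x}}^{-1}L^{\mathrm T}A_{W,I_n}^{\dagger}D_{|A|\,|\mathbf{x}|}\big\|_\infty+\big\|D_{L^{\mathrm T}\mathbf{x}}^{-1}L^{\mathrm T}A_{W,I_n}^{\dagger}D_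{|\mathbf{b}|}\big\|_\infty.$$
   Context: Notation: $A_{W,I_n}^{\dagger}=(A^{\mathrm T}WA)^{-1}A^{\mathrm T}W$; $\mathbf{x}=A_{W,I_n}^{\dagger}\mathbf{b}$; $\mathbf{d}=W(\mathbf{b}-A\mathbf{x})$; $|\cdot|$ is the entrywise absolute value; $D_{\mathbf{v}}=\mathrm{diag}(\mathbf{v})$ for a vector $\mathbf{v}$; $\|\cdot\|_\infty$ of a matrix is the maximum absolute row sum. Condition numbers: $W$ and $L$ are fixed and $g$ is a function of the data $(A,\mathbf{b})$. A perturbation $(\Delta A,\Delta\mathbf{b})\in\mathbb{R}^{m\times n}\times\mathbb{R}^m$ is admissible if each of its entries vanishes wherever the corresponding entry of $(A,\mathbf{b})$ vanishes. For admissible perturbations, $\|(\Delta A,\Delta\mathbf{b})\|_c=\min\{\omega:\ |\Delta A|\le\omega|A|,\ |\Delta\mathbf{b}|\le\omega|\mathbf{b}|\}$ (entrywise). For a norm $\|\cdot\|_G$ on $\mathbb{R}^k$ the condition number is $\max\{\|g'(A,\mathbf{b})\cdot(\Delta A,\Delta\mathbf{b})\|_G:\ (\Delta A,\Delta\mathbf{b})\text{ admissible},\ \|(\Delta A,\Delta\mathbf{b})\|_c=1\}$, where $g'$ is the Fréchet derivative. It is denoted $\mathcal{K}_\infty$ when $\|\cdot\|_G=\|\cdot\|_\infty$, and $\mathcal{K}_c$ when $\|\mathbf{u}\|_G=\max_{1\le i\le k}|u_i|/|(L^{\mathrm T}\mathbf{x})_i|$. *)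

theory Defs
  imports "HOL-Analysis.Analysis"
begin

definition diag_matrix :: "real ^ 'n \<Rightarrow> real ^ 'n ^ 'n" where
  "diag_matrix v = (\<chi> i j. if i = j then v $ i else 0)"

definition matrix_infnorm :: "real ^ 'n ^ 'm \<Rightarrow> real" where
  "matrix_infnorm M = Max (range (\<lambda>i. \<Sum>j\<in>UNIV. \<bar>M $ i $ j\<bar>))"

definition sym_pos_def :: "real ^ 'm ^ 'm \<Rightarrow> bool" where
  "sym_pos_def W \<longleftrightarrow> transpose W = W \<and> (\<forall>v. v \<noteq> 0 \<longrightarrow> v \<bullet> (W *v v) > 0)"

definition weighted_pinv :: "real ^ 'm ^ 'm \<Rightarrow> real ^ 'n ^ 'm \<Rightarrow> real ^ 'm ^ 'n" where
  "weighted_pinv W A = matrix_inv (transpose A ** W ** A) ** transpose A ** W"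

definition wls_solution :: "real ^ 'm ^ 'm \<Rightarrow> real ^ 'n ^ 'm \<Rightarrow> real ^ 'm \<Rightarrow> real ^ 'n" where
  "wls_solution W A b = weighted_pinv W A *v b"

definition wls_residual :: "real ^ 'm ^ 'm \<Rightarrow> real ^ 'n ^ 'm \<Rightarrow> real ^ 'm \<Rightarrow> real ^ 'm" where
  "wls_residual W A b = W *v (b - A *v wls_solution W A b)"

text \<open>The map is total because \<^const>\<open>matrix_inv\<close> is; its values at rank deficient matrices are
  irrelevant below, since the matrices of full column rank form an open set.\<close>
definition wls_map ::
  "real ^ 'm ^ 'm \<Rightarrow> real ^ 'k ^ 'n \<Rightarrow> (real ^ 'n ^ 'm) \<times> (real ^ 'm) \<Rightarrow> real ^ 'k" where
  "wls_map W L = (\<lambda>(A, b). (transpose L ** matrix_inv (transpose A ** W ** A) ** transpose A ** W) *v b)"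

definition admissible ::
  "(real ^ 'n ^ 'm) \<times> (real ^ 'm) \<Rightarrow> (real ^ 'n ^ 'm) \<times> (real ^ 'm) \<Rightarrow> bool" where
  "admissible = (\<lambda>(A, b) (dA, db).
     (\<forall>i j. A $ i $ j = 0 \<longrightarrow> dA $ i $ j = 0) \<and> (\<forall>i. b $ i = 0 \<longrightarrow> db $ i = 0))"

text \<open>Here \<open>\<le>\<close> and the absolute value are the entrywise operations on vectors and matrices.
  The minimum exists for every admissible perturbation of nonzero data.\<close>
definition perturbation_norm ::
  "(real ^ 'n ^ 'm) \<times> (real ^ 'm) \<Rightarrow> (real ^ 'n ^ 'm) \<times> (real ^ 'm) \<Rightarrow> real" where
  "perturbation_norm = (\<lambda>(A, b) (dA, db).
     (LEAST \<omega>. \<bar>dA\<bar> \<le> \<omega> *\<^sub>R \<bar>A\<bar> \<and> \<bar>db\<bar> \<le> \<omega> *\<^sub>R \<bar>b\<bar>))"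

text \<open>The argument \<open>G\<close> is the norm on the range of \<open>g\<close>. \<^const>\<open>Greatest\<close> expresses a maximum, not merely
  a supremum: its value is determined only if it is attained.\<close>
definition condition_number ::
  "(real ^ 'k \<Rightarrow> real) \<Rightarrow> ((real ^ 'n ^ 'm) \<times> (real ^ 'm) \<Rightarrow> real ^ 'k)
    \<Rightarrow> (real ^ 'n ^ 'm) \<times> (real ^ 'm) \<Rightarrow> real" where
  "condition_number G g p =
     (GREATEST c. c \<in> {G (frechet_derivative g (at p) \<delta>) |\<delta>.
        admissible p \<delta> \<and> perturbation_norm p \<delta> = 1})"

definition relative_infnorm :: "real ^ 'k \<Rightarrow> real ^ 'k \<Rightarrow> real" where
  "relative_infnorm y u = Max (range (\<lambda>i. \<bar>u $ i\<bar> / \<bar>y $ i\<bar>))"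

definition mixed_condition_number ::
  "real ^ 'm ^ 'm \<Rightarrow> real ^ 'k ^ 'n \<Rightarrow> real ^ 'n ^ 'm \<Rightarrow> real ^ 'm \<Rightarrow> real" where
  "mixed_condition_number W L A b = condition_number infnorm (wls_map W L) (A, b)"

definition componentwise_condition_number ::
  "real ^ 'm ^ 'm \<Rightarrow> real ^ 'k ^ 'n \<Rightarrow> real ^ 'n ^ 'm \<Rightarrow> real ^ 'm \<Rightarrow> real" where
  "componentwise_condition_number W L A b =
     condition_number (relative_infnorm (transpose L *v wls_solution W A b)) (wls_map W L) (A, b)"

end

theory Submission
  imports Defs
begin

text \<open>
  Write \<open>M = A\<^sup>T W A\<close>, \<open>x\<close> for the weighted least squares solution and \<open>d = W (b - A x)\<close>.
  Full column rank and positive definiteness make \<open>M\<close> invertible, so \<open>x\<close> solves the normal equations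
  \<open>M x = A\<^sup>T W b\<close>; differentiating these gives the derivative of the solution map,
  \<open>L\<^sup>T M\<^sup>-\<^sup>1 (dA\<^sup>T d + A\<^sup>T W (db - dA x))\<close>, which is \<open>wls_map_has_derivative\<close>.
  A perturbation of componentwise size one satisfies \<open>\<bar>dA\<bar> \<le> \<bar>A\<bar>\<close> and \<open>\<bar>db\<bar> \<le> \<bar>b\<bar>\<close>, hence
  \<open>\<bar>dA\<^sup>T d\<bar> \<le> \<bar>A\<bar>\<^sup>T \<bar>d\<bar>\<close> and \<open>\<bar>dA x\<bar> \<le> \<bar>A\<bar> \<bar>x\<bar>\<close>. If \<open>\<bar>v\<bar> \<le> u\<close>, then
  \<open>\<parallel>N v\<parallel>\<close> is at most the norm of \<open>N D\<^sub>u\<close> (\<open>infnorm_mult_vec_le\<close>), and the triangle inequality,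
  applied to the three terms of the derivative, produces the three terms of the bound.

  Both condition numbers are instances of one estimate, \<open>condition_number_wls_le\<close>: the norm on the
  range is \<open>\<parallel>N u\<parallel>\<close>, where \<open>N\<close> is the identity in the mixed case and the inverse of the diagonal matrix
  of \<open>L\<^sup>T x\<close> in the componentwise case.

  A condition number is by definition a maximum, and its value is known only once this maximum
  is known to be attained. This is the content of \<open>condition_number_le\<close>: the perturbations
  with \<open>\<bar>dA\<bar> \<le> \<bar>A\<bar>\<close>, \<open>\<bar>db\<bar> \<le> \<bar>b\<bar>\<close> form a compact box, so the size of the derivative has a maximum on
  the box, and by homogeneity a maximizer can be rescaled to componentwise size exactly one.
\<close>

section \<open>Differentiating products and matrix inverses\<close>

text \<open>If one factor vanishes at the point, the product rule needs no derivative of the other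
  factor: the term \<open>(f q - f p) (h q)\<close> is a null function times a function of order \<open>q - p\<close>. This is
  what makes continuity of the matrix inverse sufficient below.\<close>
lemma (in bounded_bilinear) has_derivative_prod_vanishing:
  assumes f: "isCont f p" and h: "(h has_derivative h') (at p)" and "h p = 0"
  shows "((\<lambda>q. prod (f q) (h q)) has_derivative (\<lambda>\<delta>. prod (f p) (h' \<delta>))) (at p)"
proof -
  have lin: "bounded_linear h'"
    using h by (rule has_derivative_bounded_linear)
  obtain C where C: "\<And>v. norm (h' v) \<le> norm v * C"
    using bounded_linear.bounded[OF lin] by blast
  obtain K where K: "\<And>u v. norm (prod u v) \<le> norm u * norm v * K"
    using bounded by blast
  define e where "e q = norm (h q - h p - h' (q - p)) / norm (q - p)" for q
  have e: "(e \<longlongrightarrow> 0) (at p)"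
    using h unfolding has_derivative_iff_norm e_def by blast
  have f0: "((\<lambda>q. f q - f p) \<longlongrightarrow> 0) (at p)"
    using f by (simp add: isCont_def LIM_zero_iff)
  have small: "((\<lambda>q. prod (f q - f p) (h q)) has_derivative (\<lambda>\<delta>. 0)) (at p)"
  proof (rule has_derivativeI_sandwich[where e = 1 and H = "\<lambda>q. norm (f q - f p) * (C + e q) * \<bar>K\<bar>"])
    show "((\<lambda>q. norm (f q - f p) * (C + e q) * \<bar>K\<bar>) \<longlongrightarrow> 0) (at p)"
    proof -
      have "((\<lambda>q. norm (f q - f p) * (C + e q) * \<bar>K\<bar>) \<longlongrightarrow> 0 * (C + 0) * \<bar>K\<bar>) (at p)"
        by (intro tendsto_mult tendsto_add tendsto_const e tendsto_norm_zero f0)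
      then show ?thesis by simp
    qed
  next
    fix q assume "q \<in> UNIV" "q \<noteq> p" "dist q p < 1"
    then have pos: "norm (q - p) > 0" by simp
    have "h q = h' (q - p) + (h q - h p - h' (q - p))"
      using \<open>h p = 0\<close> by simp
    then have "norm (h q) \<le> norm (h' (q - p)) + norm (h q - h p - h' (q - p))"
      by (metis norm_triangle_ineq)
    also have "\<dots> \<le> (C + e q) * norm (q - p)"
      using C[of "q - p"] pos by (simp add: e_def algebra_simps)
    finally have hq: "norm (h q) \<le> (C + e q) * norm (q - p)" .
    have "norm (prod (f q - f p) (h q)) \<le> norm (f q - f p) * norm (h q) * \<bar>K\<bar>"
      using K[of "f q - f p" "h q"] by (smt (verit) mult_left_mono norm_ge_zero mult_nonneg_nonneg)
    also have "\<dots> \<le> norm (f q - f p) * ((C + e q) * norm (q - p)) * \<bar>K\<bar>"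
      by (intro mult_right_mono mult_left_mono hq) auto
    finally have "norm (prod (f q - f p) (h q)) \<le> norm (f q - f p) * (C + e q) * \<bar>K\<bar> * norm (q - p)"
      by (simp add: mult_ac)
    then show "norm (prod (f q - f p) (h q) - prod (f p - f p) (h p) - 0) / norm (q - p)
                 \<le> norm (f q - f p) * (C + e q) * \<bar>K\<bar>"
      using pos by (simp add: \<open>h p = 0\<close> zero_left zero_right divide_le_eq)
  qed auto
  have "((\<lambda>q. prod (f p) (h q) + prod (f q - f p) (h q)) has_derivative
          (\<lambda>\<delta>. prod (f p) (h' \<delta>) + 0)) (at p)"
    by (intro has_derivative_add small bounded_linear.has_derivative[OF bounded_linear_right h])
  then show ?thesis
    by (simp add: diff_left)
qed

lemma bounded_bilinear_matrix_vector_mult: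
  "bounded_bilinear (\<lambda>(M :: real ^ 'n ^ 'm) v. M *v v)"
proof -
  have "bilinear (\<lambda>(M :: real ^ 'n ^ 'm) v. M *v v)"
    unfolding bilinear_def
    by (auto intro!: linearI
        simp: vec_eq_iff matrix_vector_mult_def sum.distrib sum_distrib_left algebra_simps)
  then show ?thesis
    by (simp add: bilinear_conv_bounded_bilinear)
qed

lemma bounded_linear_transpose: "bounded_linear (transpose :: real ^ 'n ^ 'm \<Rightarrow> real ^ 'm ^ 'n)"
  unfolding linear_conv_bounded_linear[symmetric]
  by (rule linearI) (simp_all add: transpose_def vec_eq_iff)

lemma matrix_inv_mult:
  fixes M :: "real ^ 'n ^ 'n"
  assumes "invertible M"
  shows "M ** matrix_inv M = mat 1" and "matrix_inv M ** M = mat 1"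
  using assms someI_ex[of "\<lambda>N. M ** N = mat 1 \<and> N ** M = mat 1"]
  by (auto simp: invertible_def matrix_inv_def)

lemma isCont_det: "isCont (det :: real ^ 'n ^ 'n \<Rightarrow> real) M"
  unfolding det_def
  by (intro continuous_intros) 

text \<open>By Cramer's rule the entries of the inverse are quotients of determinants.\<close>
lemma isCont_matrix_inv:
  fixes M :: "real ^ 'n ^ 'n"
  assumes "invertible M"
  shows "isCont matrix_inv M"
proof -
  define C :: "real ^ 'n ^ 'n \<Rightarrow> real ^ 'n ^ 'n" where
    "C N = (\<chi> k l. det (\<chi> i j. if j = k then axis l 1 $ i else N $ i $ j) / det N)" for N
  have nz: "det M \<noteq> 0"
    using assms by (simp add: invertible_det_nz)
  have inv: "matrix_inv N = C N" if "det N \<noteq> 0" for N :: "real ^ 'n ^ 'n"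
  proof -
    have "N *v (matrix_inv N *v axis l 1) = axis l 1" for l
      using that by (simp add: matrix_vector_mul_assoc matrix_inv_mult invertible_det_nz)
    then have "matrix_inv N *v axis l 1 = (\<chi> k. det (\<chi> i j. if j = k then axis l 1 $ i else N $ i $ j) / det N)" for l
      using cramer[OF that] by blast
    then have "matrix_inv N $ k $ l = C N $ k $ l" for k l
      by (metis (no_types, lifting) C_def column_def matrix_vector_mult_basis vec_lambda_beta)
    then show ?thesis by (simp add: vec_eq_iff)
  qed
  have "isCont (\<lambda>N. det (\<chi> i j. if j = k then axis l 1 $ i else N $ i $ j)) M" for k l
  proof (rule isCont_o2[OF _ isCont_det])
    have "isCont (\<lambda>N. if j = k then axis l 1 $ i else N $ i $ j) M" for i j
      by (cases "j = k") (auto intro!: continuous_intros)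
    then show "isCont (\<lambda>N. \<chi> i j. if j = k then axis l 1 $ i else N $ i $ j) M"
      unfolding isCont_def by (intro tendsto_vec_lambda) auto
  qed
  then have "isCont C M"
    unfolding C_def isCont_def using nz isCont_det[of M]
    by (intro tendsto_vec_lambda tendsto_divide) (auto simp: isCont_def)
  moreover have "\<forall>\<^sub>F N in nhds M. matrix_inv N = C N"
  proof -
    have "\<forall>\<^sub>F N in nhds M. det N \<noteq> 0"
      using isCont_det[of M] nz unfolding isCont_def tendsto_at_iff_tendsto_nhds
      by (rule tendsto_imp_eventually_ne)
    then show ?thesis by (rule eventually_mono) (rule inv)
  qed
  ultimately show ?thesis
    by (simp add: isCont_cong)
qed

section \<open>The derivative of the weighted least squares map\<close>

text \<open>A kernel vector \<open>v\<close> satisfies \<open>(A v)\<^sup>T W (A v) = 0\<close>, so \<open>A v = 0\<close> by definiteness and \<open>v = 0\<close> by the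
  rank hypothesis.\<close>
lemma invertible_gram:
  fixes A :: "real ^ 'n ^ 'm"
  assumes "rank A = CARD('n)" and "sym_pos_def W"
  shows "invertible (transpose A ** W ** A)"
proof -
  have "v = 0" if "(transpose A ** W ** A) *v v = 0" for v
  proof -
    have "(A *v v) \<bullet> (W *v (A *v v)) = v \<bullet> ((transpose A ** W ** A) *v v)"
      by (metis dot_lmul_matrix matrix_vector_mul_assoc vector_transpose_matrix)
    then have "A *v v = 0"
      using that assms(2) by (force simp: sym_pos_def_def)
    then show ?thesis
      using assms(1) matrix_nonfull_linear_equations_eq[of A] by blast
  qed
  then show ?thesis
    using matrix_left_invertible_ker invertible_left_inverse by blast
qed


text \<open>Let \<open>r (A', b') = A'\<^sup>T W (b' - A' x)\<close> be the residual of the normal equations of the perturbed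
  data at the unperturbed solution \<open>x\<close>. The perturbed solution is \<open>x + M'\<^sup>-\<^sup>1 r (A', b')\<close> as long as
  \<open>M' = A'\<^sup>T W A'\<close> is invertible. Since \<open>r\<close> vanishes at \<open>(A, b)\<close>, only \<open>r\<close> has to be differentiated.\<close>
lemma wls_map_has_derivative:
  fixes A :: "real ^ 'n ^ 'm" and b :: "real ^ 'm" and L :: "real ^ 'k ^ 'n"
  assumes inv: "invertible (transpose A ** W ** A)"
  defines "x \<equiv> wls_solution W A b"
  shows "(wls_map W L has_derivative
           (\<lambda>(dA, db). transpose L *v (matrix_inv (transpose A ** W ** A) *v
              (transpose dA *v wls_residual W A b + transpose A *v (W *v (db - dA *v x))))))
           (at (A, b))"
proof -
  define M where "M q = transpose (fst q) ** W ** fst q" for q :: "(real ^ 'n ^ 'm) \<times> (real ^ 'm)"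
  define r where "r q = transpose (fst q) *v (W *v (snd q - fst q *v x))"
    for q :: "(real ^ 'n ^ 'm) \<times> (real ^ 'm)"
  have r0: "r (A, b) = 0"
    using inv
    by (simp add: r_def x_def wls_solution_def weighted_pinv_def matrix_vector_mult_diff_distrib
        matrix_vector_mul_assoc matrix_mul_assoc matrix_inv_mult)
  have r': "(r has_derivative (\<lambda>\<delta>. transpose (fst \<delta>) *v wls_residual W A b
               + transpose A *v (W *v (snd \<delta> - fst \<delta> *v x)))) (at (A, b))"
  proof -
    have t: "((\<lambda>q :: (real ^ 'n ^ 'm) \<times> (real ^ 'm). transpose (fst q)) has_derivative (\<lambda>\<delta>. transpose (fst \<delta>))) (at (A, b))"
      by (rule bounded_linear.has_derivative[OF bounded_linear_transpose])
        (rule has_derivative_fst[OF has_derivative_ident])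
    have ax: "((\<lambda>q :: (real ^ 'n ^ 'm) \<times> (real ^ 'm). fst q *v x) has_derivative (\<lambda>\<delta>. fst \<delta> *v x)) (at (A, b))"
      by (rule bounded_linear.has_derivative
            [OF bounded_bilinear.bounded_linear_left[OF bounded_bilinear_matrix_vector_mult]])
        (rule has_derivative_fst[OF has_derivative_ident])
    have "((\<lambda>q. W *v (snd q - fst q *v x)) has_derivative (\<lambda>\<delta>. W *v (snd \<delta> - fst \<delta> *v x))) (at (A, b))"
      by (rule bounded_linear.has_derivative[OF matrix_vector_mul_bounded_linear])
        (intro has_derivative_diff ax has_derivative_snd has_derivative_ident)
    from bounded_bilinear.FDERIV[OF bounded_bilinear_matrix_vector_mult t this]
    show ?thesis
      by (simp add: r_def[abs_def] wls_residual_def x_def[symmetric] add.commute)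
  qed
  have contM: "isCont M (A, b)"
    unfolding M_def[abs_def] isCont_def matrix_matrix_mult_def transpose_def
    by (intro tendsto_vec_lambda tendsto_sum tendsto_mult)
      (auto intro!: tendsto_intros tendsto_fst[OF tendsto_ident_at, of "(A, b)" UNIV, simplified])
  have contP: "isCont (\<lambda>q. matrix_inv (M q)) (A, b)"
    by (rule isCont_o2[OF contM]) (use inv in \<open>simp add: M_def isCont_matrix_inv\<close>)
  have "((\<lambda>q. matrix_inv (M q) *v r q) has_derivative
          (\<lambda>\<delta>. matrix_inv (M (A, b)) *v (transpose (fst \<delta>) *v wls_residual W A b
               + transpose A *v (W *v (snd \<delta> - fst \<delta> *v x))))) (at (A, b))"
    by (rule bounded_bilinear.has_derivative_prod_vanishing
        [OF bounded_bilinear_matrix_vector_mult contP r' r0])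
  then have "((\<lambda>q. x + matrix_inv (M q) *v r q) has_derivative
          (\<lambda>\<delta>. matrix_inv (M (A, b)) *v (transpose (fst \<delta>) *v wls_residual W A b
               + transpose A *v (W *v (snd \<delta> - fst \<delta> *v x))))) (at (A, b))"
    using has_derivative_add[OF has_derivative_const[of x]] by fastforce
  then have D: "((\<lambda>q. transpose L *v (x + matrix_inv (M q) *v r q)) has_derivative
          (\<lambda>(dA, db). transpose L *v (matrix_inv (transpose A ** W ** A) *v
              (transpose dA *v wls_residual W A b + transpose A *v (W *v (db - dA *v x)))))) (at (A, b))"
    unfolding case_prod_beta M_def fst_conv
    by (rule bounded_linear.has_derivative[OF matrix_vector_mul_bounded_linear])
  \<comment> \<open>The representation of the perturbed solution holds only where \<open>M q\<close> is invertible, an open condition.\<close>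
  have "\<forall>\<^sub>F q in nhds (A, b). det (M q) \<noteq> 0"
  proof (rule tendsto_imp_eventually_ne)
    show "((\<lambda>q. det (M q)) \<longlongrightarrow> det (M (A, b))) (nhds (A, b))"
      using isCont_o2[OF contM isCont_det] tendsto_at_iff_tendsto_nhds[of "\<lambda>q. det (M q)"]
      by (simp add: isCont_def)
    show "det (M (A, b)) \<noteq> 0"
      using inv by (simp add: M_def invertible_det_nz)
  qed
  then have "\<forall>\<^sub>F q in nhds (A, b). transpose L *v (x + matrix_inv (M q) *v r q) = wls_map W L q"
  proof (rule eventually_mono)
    fix q assume "det (M q) \<noteq> 0"
    then have "matrix_inv (M q) *v (M q *v x) = x"
      by (simp add: matrix_vector_mul_assoc matrix_inv_mult invertible_det_nz)
    moreover have "r q = transpose (fst q) *v (W *v snd q) - M q *v x"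
      by (simp add: r_def M_def matrix_vector_mult_diff_distrib matrix_vector_mul_assoc matrix_mul_assoc
          del: transpose_matrix_vector)
    ultimately show "transpose L *v (x + matrix_inv (M q) *v r q) = wls_map W L q"
      by (simp add: wls_map_def M_def case_prod_beta matrix_vector_mult_diff_distrib
          matrix_vector_mul_assoc[symmetric] matrix_mul_assoc[symmetric] del: transpose_matrix_vector)
  qed
  then show ?thesis
    using eventually_nhds_x_imp_x by (intro has_derivative_transform_eventually[OF D])
      (auto simp: eventually_at_filter elim: eventually_mono)
qed

section \<open>Condition numbers as attained maxima\<close>

lemma dominated_entrywise:
  fixes A dA :: "real ^ 'n ^ 'm"
  shows "\<bar>dA\<bar> \<le> \<omega> *\<^sub>R \<bar>A\<bar> \<longleftrightarrow> (\<forall>i j. \<bar>dA $ i $ j\<bar> \<le> \<omega> * \<bar>A $ i $ j\<bar>)"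
  by (simp add: less_eq_vec_def abs_vec_def)

lemma dominated_entrywise_vec:
  fixes b db :: "real ^ 'm"
  shows "\<bar>db\<bar> \<le> \<omega> *\<^sub>R \<bar>b\<bar> \<longleftrightarrow> (\<forall>i. \<bar>db $ i\<bar> \<le> \<omega> * \<bar>b $ i\<bar>)"
  by (simp add: less_eq_vec_def abs_vec_def)

text \<open>The feasible \<open>\<omega>\<close> form a closed set, and since the data have a nonzero entry they are bounded
  below by zero; so the \<open>LEAST\<close> in the definition of the perturbation norm is attained.\<close>
lemma perturbation_norm_least:
  fixes A :: "real ^ 'n ^ 'm" and b :: "real ^ 'm"
  assumes "(A, b) \<noteq> 0" and "\<bar>dA\<bar> \<le> c *\<^sub>R \<bar>A\<bar>" "\<bar>db\<bar> \<le> c *\<^sub>R \<bar>b\<bar>"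
  defines "w \<equiv> perturbation_norm (A, b) (dA, db)"
  shows "\<bar>dA\<bar> \<le> w *\<^sub>R \<bar>A\<bar>" "\<bar>db\<bar> \<le> w *\<^sub>R \<bar>b\<bar>" "0 \<le> w" "w \<le> c"
proof -
  define S where "S = {\<omega>. \<bar>dA\<bar> \<le> \<omega> *\<^sub>R \<bar>A\<bar> \<and> \<bar>db\<bar> \<le> \<omega> *\<^sub>R \<bar>b\<bar>}"
  have S: "c \<in> S" using assms by (simp add: S_def)
  have nonneg: "0 \<le> \<omega>" if "\<omega> \<in> S" for \<omega>
  proof -
    \<comment> \<open>An entry \<open>v\<close> of the data that is not zero excludes negative \<open>\<omega>\<close>.\<close>
    have mult: "0 \<le> \<omega>" if "\<bar>u\<bar> \<le> \<omega> * \<bar>v\<bar>" "v \<noteq> 0" for u v :: real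
      using that by (smt (verit) mult_neg_pos)
    from \<open>(A, b) \<noteq> 0\<close> consider i j where "A $ i $ j \<noteq> 0" | i where "b $ i \<noteq> 0"
      by (auto simp: vec_eq_iff zero_prod_def)
    then show ?thesis
      using that mult unfolding S_def dominated_entrywise dominated_entrywise_vec by cases blast+
  qed
  have "closed S"
    unfolding S_def dominated_entrywise dominated_entrywise_vec
    by (intro closed_Collect_conj closed_Collect_all closed_Collect_le continuous_intros)
  moreover have "bdd_below S"
    using nonneg by (rule bdd_belowI)
  ultimately have "Inf S \<in> S" and "\<And>\<omega>. \<omega> \<in> S \<Longrightarrow> Inf S \<le> \<omega>"
    using S by (auto intro: closed_contains_Inf cInf_lower)
  then have "w = Inf S"
    unfolding w_def perturbation_norm_def S_def by (auto intro!: Least_equality)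
  with \<open>Inf S \<in> S\<close> nonneg S \<open>\<And>\<omega>. \<omega> \<in> S \<Longrightarrow> Inf S \<le> \<omega>\<close>
  show "\<bar>dA\<bar> \<le> w *\<^sub>R \<bar>A\<bar>" "\<bar>db\<bar> \<le> w *\<^sub>R \<bar>b\<bar>" "0 \<le> w" "w \<le> c"
    by (auto simp: S_def)
qed

lemma admissible_imp_dominated:
  fixes A :: "real ^ 'n ^ 'm" and b :: "real ^ 'm"
  assumes "admissible (A, b) (dA, db)"
  obtains c where "\<bar>dA\<bar> \<le> c *\<^sub>R \<bar>A\<bar>" "\<bar>db\<bar> \<le> c *\<^sub>R \<bar>b\<bar>"
proof -
  \<comment> \<open>The sum serves as a crude upper bound for the largest relative perturbation of an entry;
      entries with denominator zero contribute zero.\<close>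
  define c where "c = (\<Sum>i\<in>UNIV. \<Sum>j\<in>UNIV. \<bar>dA $ i $ j / A $ i $ j\<bar>) + (\<Sum>i\<in>UNIV. \<bar>db $ i / b $ i\<bar>)"
  have le: "\<bar>u\<bar> \<le> c * \<bar>v\<bar>" if "v = 0 \<longrightarrow> u = 0" "\<bar>u / v\<bar> \<le> c" for u v :: real
    using that by (cases "v = 0") (auto simp: abs_divide pos_divide_le_eq)
  have "\<bar>dA $ i $ j / A $ i $ j\<bar> \<le> c" for i j
  proof -
    have "\<bar>dA $ i $ j / A $ i $ j\<bar> \<le> (\<Sum>j\<in>UNIV. \<bar>dA $ i $ j / A $ i $ j\<bar>)"
      by (rule member_le_sum) auto
    also have "\<dots> \<le> (\<Sum>i\<in>UNIV. \<Sum>j\<in>UNIV. \<bar>dA $ i $ j / A $ i $ j\<bar>)"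
      by (rule member_le_sum[of i UNIV "\<lambda>i. \<Sum>j\<in>UNIV. \<bar>dA $ i $ j / A $ i $ j\<bar>"]) (auto intro: sum_nonneg)
    also have "\<dots> \<le> c" by (simp add: c_def sum_nonneg)
    finally show ?thesis .
  qed
  moreover have "\<bar>db $ i / b $ i\<bar> \<le> c" for i
  proof -
    have "\<bar>db $ i / b $ i\<bar> \<le> (\<Sum>i\<in>UNIV. \<bar>db $ i / b $ i\<bar>)"
      by (rule member_le_sum) auto
    also have "\<dots> \<le> c" by (simp add: c_def sum_nonneg)
    finally show ?thesis .
  qed
  ultimately show ?thesis
    using assms le by (intro that[of c]) (auto simp: dominated_entrywise dominated_entrywise_vec admissible_def)
qed

lemma dominated_imp_admissible:
  assumes "\<bar>dA\<bar> \<le> c *\<^sub>R \<bar>A\<bar>" "\<bar>db\<bar> \<le> c *\<^sub>R \<bar>b\<bar>"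
  shows "admissible (A, b) (dA, db)"
  using assms unfolding admissible_def dominated_entrywise dominated_entrywise_vec
  by (auto) (metis abs_le_zero_iff abs_zero mult_zero_right)+

text \<open>A feasible \<open>y\<close> for the perturbation divided by its norm \<open>w\<close> is the same as a feasible \<open>w y\<close> for the
  original one, so the least feasible values correspond too.\<close>
lemma perturbation_norm_normalize:
  fixes A :: "real ^ 'n ^ 'm" and b :: "real ^ 'm"
  assumes nz: "(A, b) \<noteq> 0" and "(dA, db) \<noteq> 0"
    and dom: "\<bar>dA\<bar> \<le> c *\<^sub>R \<bar>A\<bar>" "\<bar>db\<bar> \<le> c *\<^sub>R \<bar>b\<bar>"
  defines "w \<equiv> perturbation_norm (A, b) (dA, db)"
  shows "0 < w" "admissible (A, b) ((1 / w) *\<^sub>R (dA, db))"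
    "perturbation_norm (A, b) ((1 / w) *\<^sub>R (dA, db)) = 1"
proof -
  have w: "\<bar>dA\<bar> \<le> w *\<^sub>R \<bar>A\<bar>" "\<bar>db\<bar> \<le> w *\<^sub>R \<bar>b\<bar>" "0 \<le> w"
    unfolding w_def by (rule perturbation_norm_least[OF nz dom])+
  have "w \<noteq> 0"
  proof
    assume "w = 0"
    then have "(dA, db) = 0"
      using w by (auto simp: dominated_entrywise dominated_entrywise_vec vec_eq_iff zero_prod_def)
    then show False using assms(2) by simp
  qed
  then show "0 < w" using w by simp
  have scale: "\<bar>(1 / w) *\<^sub>R dA\<bar> \<le> y *\<^sub>R \<bar>A\<bar> \<longleftrightarrow> \<bar>dA\<bar> \<le> (w * y) *\<^sub>R \<bar>A\<bar>"
    "\<bar>(1 / w) *\<^sub>R db\<bar> \<le> y *\<^sub>R \<bar>b\<bar> \<longleftrightarrow> \<bar>db\<bar> \<le> (w * y) *\<^sub>R \<bar>b\<bar>" for y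
    using \<open>w > 0\<close>
    by (simp_all add: dominated_entrywise dominated_entrywise_vec abs_mult pos_divide_le_eq mult_ac)
  show "admissible (A, b) ((1 / w) *\<^sub>R (dA, db))"
    unfolding scaleR_Pair
    by (rule dominated_imp_admissible[of _ 1]) (use w in \<open>simp_all only: scale mult_1_right\<close>)
  have "1 \<le> y" if "\<bar>dA\<bar> \<le> (w * y) *\<^sub>R \<bar>A\<bar>" "\<bar>db\<bar> \<le> (w * y) *\<^sub>R \<bar>b\<bar>" for y
    using perturbation_norm_least(4)[OF nz that] \<open>w > 0\<close> by (simp add: w_def)
  then show "perturbation_norm (A, b) ((1 / w) *\<^sub>R (dA, db)) = 1"
    using w unfolding perturbation_norm_def scaleR_Pair case_prod_conv scale
    by (intro Least_equality) auto
qed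

lemma compact_dominated:
  "compact {(dA, db). \<bar>dA\<bar> \<le> \<bar>A :: real ^ 'n ^ 'm\<bar> \<and> \<bar>db\<bar> \<le> \<bar>b :: real ^ 'm\<bar>}"
proof -
  have "{(dA, db). \<bar>dA\<bar> \<le> \<bar>A\<bar> \<and> \<bar>db\<bar> \<le> \<bar>b\<bar>} = {- \<bar>A\<bar>..\<bar>A\<bar>} \<times> {- \<bar>b\<bar>..\<bar>b\<bar>}"
    by (auto simp: less_eq_vec_def abs_vec_def abs_le_iff minus_le_iff)
  then show ?thesis
    by (simp add: compact_Times flip: cbox_interval)
qed

text \<open>Bounding the values over the box bounds the condition number because the maximum exists. The
  perturbations of norm one lie in the box, and they contain a point where \<open>G \<circ> g'\<close> is as large as
  anywhere in the box: dividing a maximizer by its norm \<open>w \<le> 1\<close> does not decrease the value.\<close>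
lemma condition_number_le:
  fixes A :: "real ^ 'n ^ 'm" and b :: "real ^ 'm"
    and g :: "(real ^ 'n ^ 'm) \<times> (real ^ 'm) \<Rightarrow> real ^ 'k"
  assumes diff: "g differentiable (at (A, b))" and nz: "(A, b) \<noteq> 0"
    and cont: "continuous_on UNIV G" and hom: "\<And>c u. G (c *\<^sub>R u) = \<bar>c\<bar> * G u"
    and nonneg: "\<And>u. 0 \<le> G u"
    and bound: "\<And>dA db. \<bar>dA\<bar> \<le> \<bar>A\<bar> \<Longrightarrow> \<bar>db\<bar> \<le> \<bar>b\<bar> \<Longrightarrow>
                  G (frechet_derivative g (at (A, b)) (dA, db)) \<le> K"
  shows "condition_number G g (A, b) \<le> K"
proof -
  define T where "T = frechet_derivative g (at (A, b))"
  define B where "B = {(dA, db). \<bar>dA\<bar> \<le> \<bar>A\<bar> \<and> \<bar>db\<bar> \<le> \<bar>b\<bar>}"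
  define S where "S = {\<delta>. admissible (A, b) \<delta> \<and> perturbation_norm (A, b) \<delta> = 1}"
  have "linear T"
    unfolding T_def by (rule linear_frechet_derivative[OF diff])
  then have "continuous_on B (\<lambda>\<delta>. G (T \<delta>))"
    by (intro continuous_on_compose2[OF cont] linear_continuous_on) (auto simp: linear_conv_bounded_linear)
  moreover have "compact B" unfolding B_def by (rule compact_dominated)
  moreover have "(A, b) \<in> B" by (simp add: B_def)
  ultimately obtain mA mb where m: "(mA, mb) \<in> B" and max: "\<And>\<delta>. \<delta> \<in> B \<Longrightarrow> G (T \<delta>) \<le> G (T (mA, mb))"
    using continuous_attains_sup[of B "\<lambda>\<delta>. G (T \<delta>)"] by (metis empty_iff surj_pair)
  have SB: "S \<subseteq> B"
  proof clarify
    fix dA db assume "(dA, db) \<in> S"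
    then have adm: "admissible (A, b) (dA, db)" and one: "perturbation_norm (A, b) (dA, db) = 1"
      by (auto simp: S_def)
    obtain c where "\<bar>dA\<bar> \<le> c *\<^sub>R \<bar>A\<bar>" "\<bar>db\<bar> \<le> c *\<^sub>R \<bar>b\<bar>"
      using admissible_imp_dominated[OF adm] .
    then show "(dA, db) \<in> B"
      using perturbation_norm_least[OF nz] one unfolding B_def by (metis (mono_tags) case_prodI mem_Collect_eq scaleR_one)
  qed
  have attained: "\<exists>\<delta>\<in>S. G (T (mA, mb)) \<le> G (T \<delta>)"
  proof (cases "(mA, mb) = 0")
    case True
    \<comment> \<open>The maximum is zero, so any perturbation of norm one attains it; the data themselves,
        after normalization, provide one.\<close>
    have "S \<noteq> {}"
      using perturbation_norm_normalize(2,3)[OF nz nz, of 1] by (force simp: S_def)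
    then show ?thesis
      using True nonneg linear_0[OF \<open>linear T\<close>] hom[of 0 0] by auto
  next
    case False
    define w where "w = perturbation_norm (A, b) (mA, mb)"
    define \<delta> where "\<delta> = (1 / w) *\<^sub>R (mA, mb)"
    have m1: "\<bar>mA\<bar> \<le> 1 *\<^sub>R \<bar>A\<bar>" "\<bar>mb\<bar> \<le> 1 *\<^sub>R \<bar>b\<bar>"
      using m by (simp_all add: B_def)
    have "w > 0" and "\<delta> \<in> S"
      using perturbation_norm_normalize[OF nz False m1] by (simp_all add: S_def \<delta>_def w_def)
    have "w \<le> 1"
      unfolding w_def by (rule perturbation_norm_least(4)[OF nz m1])
    have "G (T \<delta>) * w = G (T (mA, mb))"
      using \<open>w > 0\<close> linear_cmul[OF \<open>linear T\<close>] by (simp add: \<delta>_def hom del: scaleR_Pair)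
    then have "G (T (mA, mb)) \<le> G (T \<delta>)"
      using \<open>w \<le> 1\<close> nonneg by (metis mult.right_neutral mult_left_mono)
    then show ?thesis using \<open>\<delta> \<in> S\<close> by blast
  qed
  then obtain \<delta> where "\<delta> \<in> S" and \<delta>: "G (T (mA, mb)) = G (T \<delta>)"
    using SB max by (meson antisym subsetD)
  have "condition_number G g (A, b) = G (T (mA, mb))"
    unfolding condition_number_def T_def[symmetric]
  proof (rule Greatest_equality)
    show "G (T (mA, mb)) \<in> {G (T \<delta>) |\<delta>. admissible (A, b) \<delta> \<and> perturbation_norm (A, b) \<delta> = 1}"
      using \<open>\<delta> \<in> S\<close> \<delta> unfolding S_def by blast
  qed (use max SB in \<open>auto simp: S_def\<close>)
  also have "\<dots> \<le> K"
    using bound m by (simp add: B_def T_def)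
  finally show ?thesis .
qed

section \<open>Bounding the derivative\<close>

lemma infnorm_mult_vec_le:
  fixes N :: "real ^ 'n ^ 'k"
  assumes "\<And>j. \<bar>v $ j\<bar> \<le> u $ j"
  shows "infnorm (N *v v) \<le> matrix_infnorm (N ** diag_matrix u)"
proof -
  have "\<bar>(N *v v) $ i\<bar> \<le> matrix_infnorm (N ** diag_matrix u)" for i
  proof -
    have u: "0 \<le> u $ j" for j using assms[of j] by linarith
    have entry: "(N ** diag_matrix u) $ i $ j = N $ i $ j * u $ j" for j
      by (simp add: matrix_matrix_mult_def diag_matrix_def if_distrib cong: if_cong)
    have "\<bar>(N *v v) $ i\<bar> \<le> (\<Sum>j\<in>UNIV. \<bar>N $ i $ j * v $ j\<bar>)"
      by (simp add: matrix_vector_mult_def)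
    also have "\<dots> \<le> (\<Sum>j\<in>UNIV. \<bar>(N ** diag_matrix u) $ i $ j\<bar>)"
      using assms u by (intro sum_mono) (simp add: entry abs_mult mult_left_mono)
    also have "\<dots> \<le> matrix_infnorm (N ** diag_matrix u)"
      unfolding matrix_infnorm_def by (intro Max_ge) auto
    finally show ?thesis .
  qed
  then show ?thesis
    unfolding infnorm_cart by (intro cSup_least) auto
qed

lemma abs_mult_vec_le:
  fixes N N' :: "real ^ 'n ^ 'k"
  assumes "\<bar>N\<bar> \<le> \<bar>N'\<bar>"
  shows "\<bar>(N *v v) $ i\<bar> \<le> (\<bar>N'\<bar> *v \<bar>v\<bar>) $ i"
proof -
  have "\<bar>(N *v v) $ i\<bar> \<le> (\<Sum>j\<in>UNIV. \<bar>N $ i $ j * v $ j\<bar>)"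
    by (simp add: matrix_vector_mult_def)
  also have "\<dots> \<le> (\<Sum>j\<in>UNIV. \<bar>N' $ i $ j\<bar> * \<bar>v $ j\<bar>)"
    using assms by (intro sum_mono) (simp add: abs_mult mult_right_mono less_eq_vec_def abs_vec_def)
  finally show ?thesis
    by (simp add: matrix_vector_mult_def abs_vec_def)
qed

lemma matrix_inv_diag_vec:
  fixes y :: "real ^ 'k"
  assumes "\<And>i. y $ i \<noteq> 0"
  shows "(matrix_inv (diag_matrix y) *v u) $ i = u $ i / y $ i"
proof -
  have mult: "(diag_matrix z *v v) $ i = z $ i * v $ i" for z v :: "real ^ 'k" and i
    by (simp add: matrix_vector_mult_def diag_matrix_def if_distrib if_distribR cong: if_cong)
  have "invertible (diag_matrix y)"
    unfolding invertible_left_inverse matrix_left_invertible_ker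
    using assms by (auto simp: vec_eq_iff mult)
  then have "diag_matrix y *v (matrix_inv (diag_matrix y) *v u) = u"
    by (simp add: matrix_vector_mul_assoc matrix_inv_mult)
  then show ?thesis
    using mult[of y "matrix_inv (diag_matrix y) *v u" i] assms[of i] by (simp add: field_simps)
qed

text \<open>This turns the norm that defines the componentwise condition number into the maximum norm
  composed with a linear map, the common form in which both condition numbers are estimated.\<close>
lemma relative_infnorm_eq_infnorm:
  fixes y :: "real ^ 'k"
  assumes "\<And>i. y $ i \<noteq> 0"
  shows "relative_infnorm y = (\<lambda>u. infnorm (matrix_inv (diag_matrix y) *v u))"
proof
  fix u
  have "infnorm (matrix_inv (diag_matrix y) *v u) = Sup (range (\<lambda>i. \<bar>u $ i\<bar> / \<bar>y $ i\<bar>))"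
    by (simp add: infnorm_cart matrix_inv_diag_vec[OF assms] abs_divide full_SetCompr_eq)
  then show "relative_infnorm y u = infnorm (matrix_inv (diag_matrix y) *v u)"
    by (simp add: relative_infnorm_def cSup_eq_Max)
qed

text \<open>The derivative splits into a term in \<open>dA\<^sup>T d\<close>, a term in \<open>dA x\<close> and a term in \<open>db\<close>. Each one is a
  fixed matrix applied to a vector whose entries are dominated by those of \<open>\<bar>A\<bar>\<^sup>T \<bar>d\<bar>\<close>, \<open>\<bar>A\<bar> \<bar>x\<bar>\<close> and \<open>\<bar>b\<bar>\<close>
  respectively.\<close>
lemma condition_number_wls_le:
  fixes A :: "real ^ 'n ^ 'm" and b :: "real ^ 'm" and L :: "real ^ 'k ^ 'n" and N :: "real ^ 'k ^ 'l"
  assumes rank: "rank A = CARD('n)" and spd: "sym_pos_def W"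
  shows "condition_number (\<lambda>u. infnorm (N *v u)) (wls_map W L) (A, b)
    \<le> matrix_infnorm (N ** transpose L ** matrix_inv (transpose A ** W ** A)
          ** diag_matrix (transpose \<bar>A\<bar> *v \<bar>wls_residual W A b\<bar>))
      + matrix_infnorm (N ** transpose L ** weighted_pinv W A ** diag_matrix (\<bar>A\<bar> *v \<bar>wls_solution W A b\<bar>))
      + matrix_infnorm (N ** transpose L ** weighted_pinv W A ** diag_matrix \<bar>b\<bar>)"
    (is "_ \<le> ?K1 + ?K2 + ?K3")
proof (rule condition_number_le)
  define P where "P = matrix_inv (transpose A ** W ** A)"
  define d where "d = wls_residual W A b"
  define x where "x = wls_solution W A b"
  have deriv: "(wls_map W L has_derivative (\<lambda>(dA, db). transpose L *v (P *v
              (transpose dA *v d + transpose A *v (W *v (db - dA *v x)))))) (at (A, b))"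
    unfolding P_def d_def x_def
    by (rule wls_map_has_derivative[OF invertible_gram[OF rank spd]])
  then show "wls_map W L differentiable at (A, b)"
    unfolding differentiable_def by blast
  have "A \<noteq> 0"
    using rank zero_less_card_finite[where 'a = 'n] by force
  then show "(A, b) \<noteq> 0" by (simp add: zero_prod_def)
  show "continuous_on UNIV (\<lambda>u. infnorm (N *v u))"
    by (intro continuous_on_infnorm linear_continuous_on) auto
  show "0 \<le> infnorm (N *v u)" for u
    by (rule infnorm_pos_le)
  show "infnorm (N *v (c *\<^sub>R u)) = \<bar>c\<bar> * infnorm (N *v u)" for c u
    by (simp add: infnorm_mul matrix_vector_mult_scaleR)
  fix dA :: "real ^ 'n ^ 'm" and db :: "real ^ 'm"
  assume dA: "\<bar>dA\<bar> \<le> \<bar>A\<bar>" and db: "\<bar>db\<bar> \<le> \<bar>b\<bar>"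
  have "\<bar>transpose dA\<bar> \<le> \<bar>transpose A\<bar>" and "transpose \<bar>A\<bar> = \<bar>transpose A\<bar>"
    using dA by (simp_all add: less_eq_vec_def abs_vec_def transpose_def)
  then have 1: "infnorm ((N ** transpose L ** P) *v (transpose dA *v d)) \<le> ?K1"
    unfolding P_def d_def by (intro infnorm_mult_vec_le) (simp add: abs_mult_vec_le del: transpose_matrix_vector)
  have 2: "infnorm ((N ** transpose L ** weighted_pinv W A) *v (dA *v x)) \<le> ?K2"
    unfolding x_def by (intro infnorm_mult_vec_le abs_mult_vec_le dA)
  have 3: "infnorm ((N ** transpose L ** weighted_pinv W A) *v db) \<le> ?K3"
    using db by (intro infnorm_mult_vec_le) (simp add: less_eq_vec_def abs_vec_def)
  have "frechet_derivative (wls_map W L) (at (A, b)) (dA, db)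
      = transpose L *v (P *v (transpose dA *v d + transpose A *v (W *v (db - dA *v x))))"
    unfolding frechet_derivative_at[OF deriv, symmetric] by (simp only: case_prod_conv)
  then have split: "N *v frechet_derivative (wls_map W L) (at (A, b)) (dA, db)
      = (N ** transpose L ** P) *v (transpose dA *v d)
        + - ((N ** transpose L ** weighted_pinv W A) *v (dA *v x))
        + (N ** transpose L ** weighted_pinv W A) *v db"
    (is "_ = ?v1 + - ?v2 + ?v3")
    by (simp add: weighted_pinv_def P_def matrix_vector_mult_diff_distrib matrix_vector_right_distrib
        matrix_vector_mul_assoc matrix_mul_assoc del: transpose_matrix_vector)
  have "infnorm (?v1 + - ?v2 + ?v3) \<le> infnorm ?v1 + infnorm ?v2 + infnorm ?v3"
    using infnorm_triangle[of "?v1 + - ?v2" ?v3] infnorm_triangle[of ?v1 "- ?v2"]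
      infnorm_neg[of ?v2] by linarith
  then show "infnorm (N *v frechet_derivative (wls_map W L) (at (A, b)) (dA, db)) \<le> ?K1 + ?K2 + ?K3"
    unfolding split using 1 2 3 by linarith
qed

theorem theorem10:
  fixes A :: "real ^ 'n ^ 'm" and b :: "real ^ 'm"
    and W :: "real ^ 'm ^ 'm" and L :: "real ^ 'k ^ 'n"
  assumes "CARD('n) \<le> CARD('m)" and "rank A = CARD('n)"
    and "sym_pos_def W" and "CARD('k) \<le> CARD('n)"
  shows "let x = wls_solution W A b; d = wls_residual W A b;
             P = matrix_inv (transpose A ** W ** A); Ad = weighted_pinv W A;
             Di = matrix_inv (diag_matrix (transpose L *v x))
         in mixed_condition_number W L A b
              \<le> matrix_infnorm (transpose L ** P ** diag_matrix (transpose \<bar>A\<bar> *v \<bar>d\<bar>))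
                + matrix_infnorm (transpose L ** Ad ** diag_matrix (\<bar>A\<bar> *v \<bar>x\<bar>))
                + matrix_infnorm (transpose L ** Ad ** diag_matrix \<bar>b\<bar>)
          \<and> ((\<forall>i. (transpose L *v x) $ i \<noteq> 0) \<longrightarrow>
             componentwise_condition_number W L A b
              \<le> matrix_infnorm (Di ** transpose L ** P ** diag_matrix (transpose \<bar>A\<bar> *v \<bar>d\<bar>))
                + matrix_infnorm (Di ** transpose L ** Ad ** diag_matrix (\<bar>A\<bar> *v \<bar>x\<bar>))
                + matrix_infnorm (Di ** transpose L ** Ad ** diag_matrix \<bar>b\<bar>))"
  unfolding Let_def mixed_condition_number_def componentwise_condition_number_def
  using condition_number_wls_le[OF assms(2,3), of "mat 1 :: real ^ 'k ^ 'k" L b,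
      unfolded matrix_vector_mul_lid matrix_mul_lid]
    condition_number_wls_le[OF assms(2,3),
      of "matrix_inv (diag_matrix (transpose L *v wls_solution W A b))" L b]
    relative_infnorm_eq_infnorm[of "transpose L *v wls_solution W A b"]
  by (auto simp del: transpose_matrix_vector)

end
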